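(* Let $d\ge 2$ be an integer and $\alpha\in[0,1]$. Let $\Gamma_d(\alpha)$ be the symmetric $d\times d$ matrix $$\Gamma_d(\alpha)=\begin{pmatrix}1&0&\cdots&0&\alpha\\ 0&1&\cdots&0&\alpha\\ \vdots&\vdots&\ddots&\vdots&\vdots\\ 0&0&\cdots&1&\alpha\\ \alpha&\alpha&\cdots&\alpha&1\end{pmatrix},$$ i.e. with diagonal entries $1$, entries $(i,d)$ and $(d,i)$ equal to $\alpha$ for $i=1,\ldots,d-1$, and all other entries $0$. Then $\Gamma_d(\alpha)$ is a tail-dependence matrix if and only if $0\le\alpha\le 1/(d-1)$.
   Context: All random variables live on an atomless probability space. The (lower) tail-dependence coefficient of two random variables $X_1\sim F_1$, $X_2\sim F_2$ with continuous distribution functions is $\lambda=\lim_{u\downarrow 0}\frac{1}{u}\mathbb{P}(F_1(X_1)\le u,\ F_2(X_2)\le u)$, given that the limit exists. The tail-dependence matrix of a random vector $\mathbf{X}=(X_1,\ldots,X_d)$ with continuous marginal distributions (for which all pairwise limits exist) is $(\lambda_{ij})_{d\times d}$, where $\lambda_{ij}$ is the tail-dependence coefficient of $X_i$ and $X_j$. A matrix is called a tail-dependence matrix if it is the tail-dependence matrix of some such random vector. *)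

theory Defs
  imports "HOL-Probability.Probability" "Jordan_Normal_Form.Matrix"
begin

definition atomless :: "'a measure \<Rightarrow> bool" where
  "atomless M \<longleftrightarrow>
     (\<forall>A\<in>sets M. 0 < emeasure M A \<longrightarrow>
        (\<exists>B\<in>sets M. B \<subseteq> A \<and> 0 < emeasure M B \<and> emeasure M B < emeasure M A))"

definition distribution_function :: "'a measure \<Rightarrow> ('a \<Rightarrow> real) \<Rightarrow> real \<Rightarrow> real" where
  "distribution_function M X = cdf (distr M borel X)"

(* A relation rather than a function: it also asserts that the limit exists. *)
definition has_tail_dependence_coefficient ::
    "'a measure \<Rightarrow> ('a \<Rightarrow> real) \<Rightarrow> ('a \<Rightarrow> real) \<Rightarrow> real \<Rightarrow> bool" where
  "has_tail_dependence_coefficient M X Y l \<longleftrightarrow>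
     ((\<lambda>u. (1 / u) * measure M {\<omega> \<in> space M.
              distribution_function M X (X \<omega>) \<le> u \<and> distribution_function M Y (Y \<omega>) \<le> u})
        \<longlongrightarrow> l) (at_right 0)"

(* The d components of the random vector are X 0, ..., X (d - 1). *)
definition has_tail_dependence_matrix ::
    "'a measure \<Rightarrow> nat \<Rightarrow> (nat \<Rightarrow> 'a \<Rightarrow> real) \<Rightarrow> real mat \<Rightarrow> bool" where
  "has_tail_dependence_matrix M d X A \<longleftrightarrow>
     A \<in> carrier_mat d d \<and>
     (\<forall>i<d. X i \<in> borel_measurable M \<and> continuous_on UNIV (distribution_function M (X i))) \<and>
     (\<forall>i<d. \<forall>j<d. has_tail_dependence_coefficient M (X i) (X j) (A $$ (i, j)))"

(* The probability space M on which all random variables live is a parameter. *)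
definition is_tail_dependence_matrix :: "'a measure \<Rightarrow> real mat \<Rightarrow> bool" where
  "is_tail_dependence_matrix M A \<longleftrightarrow> (\<exists>X. has_tail_dependence_matrix M (dim_row A) X A)"

(* Indices are 0-based, so the last row and column have index d - 1. *)
definition Gamma_mat :: "nat \<Rightarrow> real \<Rightarrow> real mat" where
  "Gamma_mat d \<alpha> = Matrix.mat d d (\<lambda>(i, j).
     if i = j then 1 else if i = d - 1 \<or> j = d - 1 then \<alpha> else 0)"

end

theory Submission
  imports Defs
begin

text \<open>Write \<open>T i u\<close> for the lower tail event of component \<open>i\<close>. If the first \<open>d - 1\<close> components
  are pairwise tail independent, their tail events are disjoint up to probability \<open>o(u)\<close>, so the
  events \<open>T i u \<inter> T (d - 1) u\<close>, of probability about \<open>\<alpha> * u\<close> each, essentially have to fit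
  disjointly into \<open>T (d - 1) u\<close>, of probability about \<open>u\<close>.

  Conversely, on an atomless space there is a uniform variable \<open>U\<close>. For weights \<open>w k s \<ge> 0\<close> with
  \<open>(\<Sum>s. w k s) = 1\<close>, let component \<open>k\<close> be a function of \<open>U\<close> whose lower tail consists, in each of
  finitely many slots \<open>s\<close> of the unit interval, of an initial piece of length proportional to
  \<open>w k s\<close>. The tail dependence coefficients are then \<open>(\<Sum>s. min (w k s) (w l s))\<close>, and weights
  realising the given matrix exist as soon as \<open>1 - (d - 1) * \<alpha> \<ge> 0\<close>.\<close>

section \<open>Necessity: pairwise overlaps of lower tail events\<close>

text \<open>Adding one more set to a union loses only its overlap with that union, which by
  subadditivity costs at most the pairwise overlaps with the earlier sets. Only pairs occur on the
  right, matching the information in a tail-dependence matrix.\<close>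

lemma (in prob_space) bonferroni_lower_bound:
  fixes n :: nat
  assumes "\<And>i. i < n \<Longrightarrow> B i \<in> events"
  shows "(\<Sum>i<n. prob (B i)) \<le> prob (\<Union>i<n. B i) + (\<Sum>j<n. \<Sum>i<j. prob (B i \<inter> B j))"
  using assms
proof (induction n)
  case 0
  then show ?case by simp
next
  case (Suc n)
  let ?U = "\<Union>i<n. B i"
  have U: "?U \<in> events" and Bn: "B n \<in> events" using Suc.prems by auto
  have "prob (?U \<union> B n) = prob ?U + prob (B n) - prob (?U \<inter> B n)"
    using finite_measure_Union'[OF U Bn] finite_measure_Diff'[OF Bn U]
    by (simp add: Int_commute)
  moreover have "prob (?U \<inter> B n) \<le> (\<Sum>i<n. prob (B i \<inter> B n))"
  proof -
    have "prob (\<Union>i<n. B i \<inter> B n) \<le> (\<Sum>i<n. prob (B i \<inter> B n))"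
      using Suc.prems by (intro finite_measure_subadditive_finite) auto
    then show ?thesis by (simp add: Int_UN_distrib2)
  qed
  moreover have "(\<Union>i<Suc n. B i) = ?U \<union> B n" by (auto simp: lessThan_Suc)
  moreover have "(\<Sum>i<n. prob (B i)) \<le> prob ?U + (\<Sum>j<n. \<Sum>i<j. prob (B i \<inter> B j))"
    using Suc by simp
  ultimately show ?case by simp
qed

lemma (in prob_space) distribution_function_eq:
  assumes [measurable]: "X \<in> borel_measurable M"
  shows "distribution_function M X x = prob {\<omega> \<in> space M. X \<omega> \<le> x}"
  unfolding distribution_function_def cdf_def
  by (subst measure_distr) (auto intro!: arg_cong[where f=prob])

text \<open>The Bonferroni bound for the events \<open>T i u \<inter> T n u\<close>, divided by
  \<open>u\<close>, passes to the limit term by term. Triple intersections have no prescribed limit,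
  so they are first enlarged to \<open>T i u \<inter> T j u\<close>, whose coefficient is 0.\<close>

lemma (in prob_space) tail_dependence_star_bound:
  assumes X: "has_tail_dependence_matrix M (Suc n) X A"
    and diag: "A $$ (n, n) = 1"
    and col: "\<And>i. i < n \<Longrightarrow> A $$ (i, n) = \<alpha>"
    and off: "\<And>i j. i < j \<Longrightarrow> j < n \<Longrightarrow> A $$ (i, j) = 0"
  shows "real n * \<alpha> \<le> 1"
proof -
  define T where "T i u = {\<omega> \<in> space M. distribution_function M (X i) (X i \<omega>) \<le> u}" for i u
  have T: "T i u \<in> events" if "i < Suc n" for i u
  proof -
    have [measurable]: "X i \<in> borel_measurable M"
        "distribution_function M (X i) \<in> borel_measurable borel"
      using X that by (auto simp: has_tail_dependence_matrix_def intro: borel_measurable_continuous_onI)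
    show ?thesis unfolding T_def by measurable
  qed
  have lim: "((\<lambda>u. 1 / u * prob (T i u \<inter> T j u)) \<longlongrightarrow> A $$ (i, j)) (at_right 0)"
    if "i < Suc n" "j < Suc n" for i j
  proof -
    have "T i u \<inter> T j u = {\<omega> \<in> space M. distribution_function M (X i) (X i \<omega>) \<le> u \<and>
        distribution_function M (X j) (X j \<omega>) \<le> u}" for u
      by (auto simp: T_def)
    then show ?thesis
      using X that unfolding has_tail_dependence_matrix_def has_tail_dependence_coefficient_def
      by simp
  qed
  have le: "(\<Sum>i<n. prob (T i u \<inter> T n u)) \<le>
      prob (T n u \<inter> T n u) + (\<Sum>j<n. \<Sum>i<j. prob (T i u \<inter> T j u))" for u
  proof -
    have "(\<Sum>i<n. prob (T i u \<inter> T n u)) \<le> prob (\<Union>i<n. T i u \<inter> T n u) +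
        (\<Sum>j<n. \<Sum>i<j. prob ((T i u \<inter> T n u) \<inter> (T j u \<inter> T n u)))"
      using T by (intro bonferroni_lower_bound) auto
    moreover have "prob (\<Union>i<n. T i u \<inter> T n u) \<le> prob (T n u \<inter> T n u)"
      using T by (intro finite_measure_mono) auto
    moreover have "(\<Sum>j<n. \<Sum>i<j. prob ((T i u \<inter> T n u) \<inter> (T j u \<inter> T n u)))
        \<le> (\<Sum>j<n. \<Sum>i<j. prob (T i u \<inter> T j u))"
      using T by (intro sum_mono finite_measure_mono) auto
    ultimately show ?thesis by linarith
  qed
  have "(\<Sum>i<n. A $$ (i, n)) \<le> A $$ (n, n) + (\<Sum>j<n. \<Sum>i<j. A $$ (i, j))"
  proof (rule tendsto_le)
    show "((\<lambda>u. \<Sum>i<n. 1 / u * prob (T i u \<inter> T n u)) \<longlongrightarrow> (\<Sum>i<n. A $$ (i, n))) (at_right 0)"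
      by (intro tendsto_sum lim) auto
    show "((\<lambda>u. 1 / u * prob (T n u \<inter> T n u) + (\<Sum>j<n. \<Sum>i<j. 1 / u * prob (T i u \<inter> T j u))) \<longlongrightarrow>
        A $$ (n, n) + (\<Sum>j<n. \<Sum>i<j. A $$ (i, j))) (at_right 0)"
      by (intro tendsto_add tendsto_sum lim) auto
    show "\<forall>\<^sub>F u in at_right 0. (\<Sum>i<n. 1 / u * prob (T i u \<inter> T n u)) \<le>
        1 / u * prob (T n u \<inter> T n u) + (\<Sum>j<n. \<Sum>i<j. 1 / u * prob (T i u \<inter> T j u))"
      using eventually_at_right_less[of "0::real"]
    proof eventually_elim
      case (elim u)
      then show ?case
        using mult_left_mono[OF le[of u], of "1 / u"]
        by (simp only: sum_distrib_left distrib_left) simp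
    qed
  qed simp
  then show ?thesis using diag col off by simp
qed

section \<open>A uniform random variable on an atomless space\<close>

text \<open>Repeated halving: atomlessness splits a set of positive probability into two parts of
  positive probability, and the lighter one has at most half of it.\<close>

lemma (in prob_space) atomless_small_subset:
  assumes "atomless M" "A \<in> events" "prob A > 0" "e > 0"
  obtains B where "B \<in> events" "B \<subseteq> A" "0 < prob B" "prob B \<le> e"
proof -
  have "\<exists>B\<in>events. B \<subseteq> A \<and> 0 < prob B \<and> prob B \<le> prob A / 2 ^ n" for n
  proof (induction n)
    case 0
    then show ?case using assms by auto
  next
    case (Suc n)
    then obtain B where B: "B \<in> events" "B \<subseteq> A" "0 < prob B" "prob B \<le> prob A / 2 ^ n" by blast
    obtain C where C: "C \<in> events" "C \<subseteq> B" "0 < prob C" "prob C < prob B"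
      using assms(1) B unfolding atomless_def
      by (auto simp: emeasure_eq_measure ennreal_less_iff)
    have D: "prob (B - C) = prob B - prob C" using B C by (simp add: finite_measure_Diff)
    have half: "prob A / 2 ^ Suc n = (prob A / 2 ^ n) / 2" by simp
    show ?case
    proof (cases "prob C \<le> prob B / 2")
      case True
      then show ?thesis unfolding half using B C by (intro bexI[of _ C]) auto
    next
      case False
      then show ?thesis unfolding half using B C D by (intro bexI[of _ "B - C"]) auto
    qed
  qed
  moreover obtain n where "prob A / e < 2 ^ n"
    using real_arch_pow[of 2 "prob A / e"] by auto
  then have "prob A / 2 ^ n < e" using assms by (simp add: field_simps)
  ultimately obtain B where "B \<in> events" "B \<subseteq> A" "0 < prob B" "prob B \<le> prob A / 2 ^ n" by blast
  with \<open>prob A / 2 ^ n < e\<close> show ?thesis by (intro that[of B]) auto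
qed

text \<open>Exhaustion: among unions of countably many small events the supremum \<open>S\<close> of
  the probabilities is attained, since countably many near-optimal sequences merge into one. If it
  were below 1, a small subset of the remainder could be prepended, exceeding
  \<open>S\<close>.\<close>

lemma (in prob_space) atomless_small_cover:
  assumes "atomless M" "e > 0"
  obtains C :: "nat \<Rightarrow> 'a set"
  where "\<And>i. C i \<in> events" "\<And>i. prob (C i) \<le> e" "prob (\<Union>i. C i) = 1"
proof -
  define good where "good C \<longleftrightarrow> (\<forall>i::nat. C i \<in> events \<and> prob (C i) \<le> e)" for C
  define S where "S = (SUP C\<in>Collect good. prob (\<Union>i. C i))"
  have bdd: "bdd_above ((\<lambda>C. prob (\<Union>i. C i)) ` Collect good)"
    by (auto intro!: bdd_aboveI[of _ 1])
  have "good (\<lambda>_. {})" using assms by (simp add: good_def)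
  then have ne: "Collect good \<noteq> {}" by blast
  have upper: "prob (\<Union>i. C i) \<le> S" if "good C" for C
    unfolding S_def using that by (intro cSUP_upper bdd) auto
  have "\<exists>C. good C \<and> S - 1 / real (Suc n) < prob (\<Union>i. C i)" for n
    using less_cSUP_iff[OF ne bdd, of "S - 1 / real (Suc n)"] unfolding S_def by auto
  then obtain C where C: "\<And>n. good (C n)" "\<And>n. S - 1 / real (Suc n) < prob (\<Union>i. C n i)"
    by metis
  define D where "D k = (case prod_decode k of (n, i) \<Rightarrow> C n i)" for k
  have D: "good D" using C(1) by (auto simp: good_def D_def split: prod.splits)
  have ev: "(\<Union>i. D i) \<in> events" using D by (auto simp: good_def)
  have "S - 1 / real (Suc n) \<le> prob (\<Union>i. D i)" for n
  proof -
    have "C n i = D (prod_encode (n, i))" for i by (simp add: D_def)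
    then have "prob (\<Union>i. C n i) \<le> prob (\<Union>i. D i)"
      by (intro finite_measure_mono ev) auto
    then show ?thesis using C(2)[of n] by linarith
  qed
  moreover have "(\<lambda>n. S - 1 / real (Suc n)) \<longlonglongrightarrow> S"
    using tendsto_diff[OF tendsto_const[of S] LIMSEQ_Suc[OF lim_1_over_n]] by simp
  ultimately have "S \<le> prob (\<Union>i. D i)"
    by (intro LIMSEQ_le_const2[of "\<lambda>n. S - 1 / real (Suc n)" S]) auto
  have "prob (\<Union>i. D i) = 1"
  proof (rule ccontr)
    assume "prob (\<Union>i. D i) \<noteq> 1"
    then have "prob (space M - (\<Union>i. D i)) > 0"
      using prob_compl[OF ev] prob_le_1[of "\<Union>i. D i"] by linarith
    then obtain B where B: "B \<in> events" "B \<subseteq> space M - (\<Union>i. D i)" "0 < prob B" "prob B \<le> e"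
      using atomless_small_subset[OF assms(1), of "space M - (\<Union>i. D i)" e] ev assms by auto
    have "good (case_nat B D)" using D B by (auto simp: good_def split: nat.splits)
    moreover have "(\<Union>i. case_nat B D i) = B \<union> (\<Union>i. D i)"
      by (subst UNIV_nat_eq) auto
    moreover have "prob (B \<union> (\<Union>i. D i)) = prob B + prob (\<Union>i. D i)"
      using B ev by (intro finite_measure_Union) auto
    ultimately show False using upper[of "case_nat B D"] B \<open>S \<le> prob (\<Union>i. D i)\<close> by simp
  qed
  with D show ?thesis by (intro that[of D]) (auto simp: good_def)
qed

lemma ternary_summable: "summable (\<lambda>k. of_bool (a k) * (1 / 3) ^ k :: real)"
  by (rule summable_comparison_test'[of "\<lambda>k. (1 / 3) ^ k" 0]) auto

text \<open>At the first differing digit \<open>k\<close> the sums differ by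
  \<open>(1 / 3) ^ k\<close>, while all later digits together can compensate at most half of that.
  In base 2 they could compensate it exactly, so binary coding would not be injective.\<close>

lemma ternary_inject:
  assumes "(\<Sum>k. of_bool (a k) * (1 / 3) ^ k) = (\<Sum>k. of_bool (b k) * (1 / 3 :: real) ^ k)"
  shows "a = b"
proof (rule ccontr)
  assume "a \<noteq> b"
  define k where "k = (LEAST k. a k \<noteq> b k)"
  have less: "a j = b j" if "j < k" for j
    using not_less_Least[of j "\<lambda>k. a k \<noteq> b k"] that by (auto simp: k_def)
  have k: "a k \<noteq> b k"
    using \<open>a \<noteq> b\<close> LeastI_ex[of "\<lambda>k. a k \<noteq> b k"] by (auto simp: k_def)
  define c where "c j = of_bool (a j) * (1 / 3) ^ j - of_bool (b j) * (1 / 3 :: real) ^ j" for j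
  have c: "summable c" unfolding c_def by (intro summable_diff ternary_summable)
  have "suminf c = 0"
    unfolding c_def using assms by (subst suminf_diff[symmetric]) (auto intro: ternary_summable)
  moreover have "sum c {..<Suc k} = c k" using less by (simp add: c_def)
  ultimately have ck: "c k = - (\<Sum>j. c (j + Suc k))"
    using suminf_split_initial_segment[OF c, of "Suc k"] by simp
  have bound: "norm (c (j + Suc k)) \<le> (1 / 3) ^ Suc k * (1 / 3) ^ j" for j
    by (auto simp: c_def power_add of_bool_def)
  have "norm (\<Sum>j. c (j + Suc k)) \<le> (\<Sum>j. (1 / 3) ^ Suc k * (1 / 3 :: real) ^ j)"
    using bound by (intro norm_suminf_le) (auto intro!: summable_mult)
  also have "\<dots> = (1 / 3) ^ k / 2"
    by (subst suminf_mult) (auto simp: suminf_geometric)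
  finally have "\<bar>c k\<bar> \<le> (1 / 3) ^ k / 2" using ck by simp
  moreover have "\<bar>c k\<bar> = (1 / 3) ^ k" using k by (auto simp: c_def of_bool_def)
  ultimately show False by simp
qed

text \<open>Coding the membership pattern of a sequence of covers with mesh tending to 0 by ternary
  digits confines every level set to arbitrarily small sets.\<close>

lemma (in prob_space) atomless_imp_null_level_sets:
  assumes "atomless M"
  obtains V :: "'a \<Rightarrow> real"
  where "V \<in> borel_measurable M" "\<And>v. prob {\<omega> \<in> space M. V \<omega> = v} = 0"
proof -
  have "\<exists>C :: nat \<Rightarrow> 'a set. (\<forall>i. C i \<in> events \<and> prob (C i) \<le> 1 / real (Suc m)) \<and>
      prob (\<Union>i. C i) = 1" for m
    using atomless_small_cover[OF assms, of "1 / real (Suc m)"]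
    by (metis of_nat_0_less_iff zero_less_Suc zero_less_divide_1_iff)
  then obtain C :: "nat \<Rightarrow> nat \<Rightarrow> 'a set" where C: "\<And>m i. C m i \<in> events"
      "\<And>m i. prob (C m i) \<le> 1 / real (Suc m)" "\<And>m. prob (\<Union>i. C m i) = 1"
    by metis
  define E where "E k = (case prod_decode k of (m, i) \<Rightarrow> C m i)" for k
  have [measurable]: "E k \<in> events" for k using C(1) by (simp add: E_def split: prod.splits)
  define V where "V \<omega> = (\<Sum>k. of_bool (\<omega> \<in> E k) * (1 / 3) ^ k :: real)" for \<omega>
  have V[measurable]: "V \<in> borel_measurable M"
    unfolding V_def of_bool_def by measurable
  have level: "prob {\<omega> \<in> space M. V \<omega> = v} \<le> 1 / real (Suc m)" for v m
  \<comment> \<open>Equal codes mean equal membership in every \<open>C m i\<close>. So a level set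
    that meets the \<open>m\<close>-th cover lies inside a single piece of it; otherwise it lies in
    the null complement of the cover.\<close>
  proof (cases "\<exists>\<omega>\<in>\<Union>i. C m i. V \<omega> = v")
    case True
    then obtain \<omega>0 i where w: "\<omega>0 \<in> C m i" "V \<omega>0 = v" by blast
    have "\<omega> \<in> C m i" if "V \<omega> = v" for \<omega>
    proof -
      have "(\<lambda>k. \<omega> \<in> E k) = (\<lambda>k. \<omega>0 \<in> E k)"
        using that w unfolding V_def by (intro ternary_inject) simp
      from fun_cong[OF this, of "prod_encode (m, i)"] show ?thesis using w by (simp add: E_def)
    qed
    then have "prob {\<omega> \<in> space M. V \<omega> = v} \<le> prob (C m i)"
      using C by (intro finite_measure_mono) auto
    then show ?thesis using C(2)[of m i] by linarith
  next
    case False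
    have ev: "(\<Union>i. C m i) \<in> events" using C by auto
    have "prob {\<omega> \<in> space M. V \<omega> = v} \<le> prob (space M - (\<Union>i. C m i))"
      using False ev by (intro finite_measure_mono) auto
    also have "\<dots> = 0" using prob_compl[OF ev] C(3) by simp
    finally show ?thesis by (rule order_trans) simp
  qed
  have "prob {\<omega> \<in> space M. V \<omega> = v} \<le> 0" for v
    by (rule LIMSEQ_le_const[OF LIMSEQ_Suc[OF lim_1_over_n]]) (use level in auto)
  then have "prob {\<omega> \<in> space M. V \<omega> = v} = 0" for v
    using measure_nonneg[of M "{\<omega> \<in> space M. V \<omega> = v}"] by (simp add: order_antisym)
  with V show ?thesis by (rule that)
qed

lemma (in prob_space) continuous_distribution_function_iff:
  assumes [measurable]: "X \<in> borel_measurable M"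
  shows "continuous_on UNIV (distribution_function M X) \<longleftrightarrow>
    (\<forall>x. prob {\<omega> \<in> space M. X \<omega> = x} = 0)"
proof -
  interpret D: real_distribution "distr M borel X" by simp
  have "measure (distr M borel X) {x} = prob {\<omega> \<in> space M. X \<omega> = x}" for x
    by (subst measure_distr) (auto intro!: arg_cong[where f=prob])
  then show ?thesis
    by (simp add: distribution_function_def continuous_on_eq_continuous_at D.isCont_cdf)
qed

text \<open>Probability integral transform: \<open>U\<close> is the continuous distribution function
  \<open>F\<close> of \<open>V\<close> applied to \<open>V\<close>. \<open>F\<close> may have flat
  pieces, so the argument uses monotonicity and the intermediate value theorem in place of an
  inverse.\<close>

lemma (in prob_space) atomless_imp_uniform:
  assumes "atomless M"
  obtains U :: "'a \<Rightarrow> real"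
  where "U \<in> borel_measurable M"
    "\<And>u. u \<in> {0..1} \<Longrightarrow> prob {\<omega> \<in> space M. U \<omega> \<le> u} = u"
    "\<And>u. prob {\<omega> \<in> space M. U \<omega> = u} = 0"
proof -
  obtain V :: "'a \<Rightarrow> real" where [measurable]: "V \<in> borel_measurable M"
      and null: "\<And>v. prob {\<omega> \<in> space M. V \<omega> = v} = 0"
    using atomless_imp_null_level_sets[OF assms] by blast
  interpret D: real_distribution "distr M borel V" by simp
  define F where "F = distribution_function M V"
  have cont: "continuous_on UNIV F"
    unfolding F_def by (subst continuous_distribution_function_iff) (auto simp: null)
  then have [measurable]: "F \<in> borel_measurable borel" by (rule borel_measurable_continuous_onI)
  have F: "F v = prob {\<omega> \<in> space M. V \<omega> \<le> v}" for v
    unfolding F_def by (rule distribution_function_eq) simp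
  have mono: "F v \<le> F v'" if "v \<le> v'" for v v'
    unfolding F using that by (intro finite_measure_mono) auto
  define U where "U = (\<lambda>\<omega>. F (V \<omega>))"
  have [measurable]: "U \<in> borel_measurable M" unfolding U_def by measurable
  have bounds: "0 \<le> U \<omega>" "U \<omega> \<le> 1" for \<omega> by (auto simp: U_def F)
  have onto: "\<exists>v. F v = u" if "0 < u" "u < 1" for u
  proof -
    have "\<forall>\<^sub>F v in at_bot. F v < u"
      unfolding F_def distribution_function_def
      by (rule order_tendstoD(2)[OF D.cdf_lim_at_bot \<open>0 < u\<close>])
    then obtain a where a: "F a < u" by (auto simp: eventually_at_bot_linorder)
    have "\<forall>\<^sub>F v in at_top. u < F v"
      unfolding F_def distribution_function_def
      by (rule order_tendstoD(1)[OF D.cdf_lim_at_top_prob \<open>u < 1\<close>])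
    then obtain b where b: "u < F b" by (auto simp: eventually_at_top_linorder)
    have "a \<le> b" using mono[of b a] a b by linarith
    then show ?thesis
      using IVT'[of F a u b] a b continuous_on_subset[OF cont] by force
  qed
  \<comment> \<open>If \<open>F v = u\<close> and \<open>F\<close> stays constant to the right of
    \<open>v\<close>, then \<open>U \<omega> \<le> u\<close> does not give
    \<open>V \<omega> \<le> v\<close>. A level \<open>u'\<close> strictly above \<open>u\<close>
    avoids this, and then \<open>u'\<close> decreases to \<open>u\<close>.\<close>
  have le: "prob {\<omega> \<in> space M. U \<omega> \<le> u} \<le> u" if "0 \<le> u" "u < 1" for u
  proof (rule dense_ge_bounded[OF \<open>u < 1\<close>])
    fix u' assume u': "u < u'" "u' < 1"
    then obtain v where v: "F v = u'" using onto[of u'] \<open>0 \<le> u\<close> by auto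
    have "V \<omega> \<le> v" if "U \<omega> \<le> u" for \<omega>
    proof (rule ccontr)
      assume "\<not> V \<omega> \<le> v"
      then have "F v \<le> F (V \<omega>)" by (intro mono) simp
      then show False using that v u' by (simp add: U_def)
    qed
    then have "prob {\<omega> \<in> space M. U \<omega> \<le> u} \<le> prob {\<omega> \<in> space M. V \<omega> \<le> v}"
      by (intro finite_measure_mono) auto
    then show "prob {\<omega> \<in> space M. U \<omega> \<le> u} \<le> u'" using v F by simp
  qed
  have ge: "u \<le> prob {\<omega> \<in> space M. U \<omega> \<le> u}" if u: "0 < u" "u < 1" for u
  proof -
    obtain v where v: "F v = u" using onto[OF u] by auto
    have "prob {\<omega> \<in> space M. V \<omega> \<le> v} \<le> prob {\<omega> \<in> space M. U \<omega> \<le> u}"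
      using mono v by (intro finite_measure_mono) (auto simp: U_def)
    then show ?thesis using v F by simp
  qed
  have unif: "prob {\<omega> \<in> space M. U \<omega> \<le> u} = u" if "u \<in> {0..1}" for u
  proof -
    consider "u = 0" | "u = 1" | "0 < u" "u < 1" using \<open>u \<in> {0..1}\<close> by fastforce
    then show ?thesis
    proof cases
      case 1
      then show ?thesis using le[of 0] measure_nonneg[of M] by (auto intro: order_antisym)
    next
      case 2
      then show ?thesis using bounds by (simp add: prob_space)
    next
      case 3
      then show ?thesis using le[of u] ge[of u] by simp
    qed
  qed
  have "prob {\<omega> \<in> space M. U \<omega> = u} = 0" for u
  proof (cases "u \<in> {0..1}")
    case False
    then have "{\<omega> \<in> space M. U \<omega> = u} = {}" using bounds by force
    then show ?thesis by (simp only: measure_empty)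
  next
    case u: True
    show ?thesis
    proof (cases "u = 0")
      case True
      then show ?thesis
        using unif[of 0] bounds by (simp add: order_antisym_conv)
    next
      case False
      have "prob {\<omega> \<in> space M. U \<omega> = u} \<le> 0 + e" if "0 < e" for e
      proof -
        \<comment> \<open>The cut-off at 0 keeps \<open>u'\<close> in the unit interval, where
          \<open>unif\<close> applies.\<close>
        define u' where "u' = max 0 (u - e)"
        have u': "u' \<in> {0..1}" "u' < u" "u - e \<le> u'" using u that False by (auto simp: u'_def)
        have "prob {\<omega> \<in> space M. U \<omega> = u} \<le>
            prob ({\<omega> \<in> space M. U \<omega> \<le> u} - {\<omega> \<in> space M. U \<omega> \<le> u'})"
          using u' by (intro finite_measure_mono) auto
        also have "\<dots> = u - u'"
          using u' u by (subst finite_measure_Diff) (auto simp: unif)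
        finally show ?thesis using u' by simp
      qed
      then have "prob {\<omega> \<in> space M. U \<omega> = u} \<le> 0" by (rule field_le_epsilon)
      then show ?thesis using measure_nonneg[of M] by (simp add: order_antisym)
    qed
  qed
  with unif show ?thesis by (intro that[of U]) auto
qed

section \<open>Slot functions on the unit interval\<close>

text \<open>The interval is cut into \<open>S\<close> slots of length \<open>1 / S\<close>. Inside slot \<open>s\<close>, the function is at
  most \<open>t \<le> 1\<close> exactly on an initial piece of length \<open>w s * t / S\<close>.\<close>

definition slot_fun :: "nat \<Rightarrow> (int \<Rightarrow> real) \<Rightarrow> real \<Rightarrow> real" where
  "slot_fun S w x = (let s = \<lceil>real S * x\<rceil> - 1; r = real S * x - real_of_int s
     in if r \<le> w s then r / w s else 1 + r)"

lemma slot_fun_measurable [measurable]: "slot_fun S w \<in> borel_measurable borel"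
proof -
  have "(\<lambda>x. (\<lambda>s x. if real S * x - real_of_int s \<le> w s then (real S * x - real_of_int s) / w s
      else 1 + (real S * x - real_of_int s)) (\<lceil>real S * x\<rceil> - 1) x) \<in> borel_measurable borel"
    by (rule measurable_compose_countable) measurable
  then show ?thesis by (simp add: slot_fun_def[abs_def] Let_def)
qed

lemma slot_fun_pos: "0 < slot_fun S w x"
proof -
  have "0 < real S * x - real_of_int (\<lceil>real S * x\<rceil> - 1)" by linarith
  then show ?thesis unfolding slot_fun_def Let_def by (auto intro: divide_pos_pos)
qed

text \<open>The offset \<open>r\<close> in the slot is positive, so the quotient branch occurs only
  for \<open>w s > 0\<close>, where it is a genuine rescaling; the other branch takes values above 1
  and never meets the level \<open>t\<close>.\<close>

lemma slot_fun_le_iff: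
  assumes "0 \<le> t" "t \<le> 1"
  shows "slot_fun S w x \<le> t \<longleftrightarrow>
    real S * x - real_of_int (\<lceil>real S * x\<rceil> - 1) \<le> w (\<lceil>real S * x\<rceil> - 1) * t"
proof -
  define s where "s = \<lceil>real S * x\<rceil> - 1"
  define r where "r = real S * x - real_of_int s"
  have r: "0 < r" unfolding r_def s_def by linarith
  show ?thesis
  proof (cases "r \<le> w s")
    case True
    then show ?thesis using r by (simp add: slot_fun_def Let_def flip: s_def r_def)
        (simp add: field_simps)
  next
    case False
    have "\<not> r \<le> w s * t"
    proof (cases "0 \<le> w s")
      case True
      then have "w s * t \<le> w s" using assms by (simp add: mult_left_le)
      then show ?thesis using False by linarith
    next
      case False
      then have "w s * t \<le> 0" using assms by (simp add: mult_nonpos_nonneg)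
      then show ?thesis using r by linarith
    qed
    then show ?thesis using False r assms
      by (simp add: slot_fun_def Let_def flip: s_def r_def)
  qed
qed

text \<open>Each branch is injective within a slot, so every slot contributes at most two points.
  The branch \<open>1 + r\<close> is not constant for this reason: it keeps the distribution
  function continuous.\<close>

lemma slot_fun_level_countable:
  assumes "S > 0"
  shows "countable {x. slot_fun S w x = t}"
proof (rule countable_subset)
  show "countable (\<Union>s. {(w s * t + real_of_int s) / real S, (t - 1 + real_of_int s) / real S})"
    by auto
  show "{x. slot_fun S w x = t} \<subseteq>
      (\<Union>s. {(w s * t + real_of_int s) / real S, (t - 1 + real_of_int s) / real S})"
  proof
    fix x assume x: "x \<in> {x. slot_fun S w x = t}"
    define s where "s = \<lceil>real S * x\<rceil> - 1"
    define r where "r = real S * x - real_of_int s"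
    have "0 < r" unfolding r_def s_def by linarith
    have "slot_fun S w x = (if r \<le> w s then r / w s else 1 + r)"
      by (simp add: slot_fun_def Let_def r_def s_def)
    then have "r = w s * t \<or> r = t - 1"
      using x \<open>0 < r\<close> by (auto simp: divide_eq_eq mult.commute split: if_splits)
    moreover have "x = (r + real_of_int s) / real S" using assms by (simp add: r_def)
    ultimately have "x = (w s * t + real_of_int s) / real S \<or> x = (t - 1 + real_of_int s) / real S"
      by auto
    then show "x \<in> (\<Union>s. {(w s * t + real_of_int s) / real S, (t - 1 + real_of_int s) / real S})"
      by blast
  qed
qed

text \<open>In each slot both lower tails are initial pieces with the same left end, hence nested;
  their intersection is the shorter one. This is the source of the minimum.\<close>

lemma slot_fun_joint_le:
  assumes "S > 0" "0 \<le> t" "t \<le> 1"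
    and w: "\<And>s. 0 \<le> w s" "\<And>s. w s \<le> 1" "\<And>s. s \<notin> {0..<int S} \<Longrightarrow> w s = 0"
  shows "{x. slot_fun S w x \<le> t \<and> slot_fun S w' x \<le> t} =
    (\<Union>s\<in>{0..<int S}. {real_of_int s / real S <.. (real_of_int s + min (w s) (w' s) * t) / real S})"
    (is "?L = ?R")
proof (intro equalityI subsetI)
  fix x assume "x \<in> ?L"
  define s where "s = \<lceil>real S * x\<rceil> - 1"
  have pos: "0 < real S * x - real_of_int s" unfolding s_def by linarith
  have le: "real S * x - real_of_int s \<le> w s * t" "real S * x - real_of_int s \<le> w' s * t"
    using \<open>x \<in> ?L\<close> slot_fun_le_iff[OF assms(2,3)] by (auto simp: s_def)
  \<comment> \<open>Outside this range \<open>w s = 0\<close> would force a nonpositive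
    offset.\<close>
  have "s \<in> {0..<int S}" using w(3)[of s] le pos by force
  moreover have "real S * x \<le> real_of_int s + min (w s) (w' s) * t"
    using le by (auto simp: min_def)
  ultimately show "x \<in> ?R" using pos assms(1) by (auto simp: field_simps intro!: bexI[of _ s])
next
  fix x assume "x \<in> ?R"
  then obtain s where s: "s \<in> {0..<int S}" "real_of_int s < real S * x"
      "real S * x \<le> real_of_int s + min (w s) (w' s) * t"
    using assms(1) by (auto simp: field_simps)
  have m: "min (w s) (w' s) * t \<le> w s * t" "min (w s) (w' s) * t \<le> w' s * t"
    using assms(2) by (auto intro: mult_right_mono)
  have "w s * t \<le> 1" using w assms by (simp add: mult_le_one)
  then have "\<lceil>real S * x\<rceil> = s + 1" using s m by (intro ceiling_unique) auto
  then show "x \<in> ?L" using s m slot_fun_le_iff[OF assms(2,3)] by auto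
qed

lemma (in prob_space) prob_slot_fun_joint:
  assumes [measurable]: "U \<in> borel_measurable M"
    and unif: "\<And>u. u \<in> {0..1} \<Longrightarrow> prob {\<omega> \<in> space M. U \<omega> \<le> u} = u"
    and "S > 0" "0 \<le> t" "t \<le> 1"
    and w: "\<And>s. 0 \<le> w s" "\<And>s. w s \<le> 1" "\<And>s. s \<notin> {0..<int S} \<Longrightarrow> w s = 0"
    and w': "\<And>s. 0 \<le> w' s"
  shows "prob {\<omega> \<in> space M. slot_fun S w (U \<omega>) \<le> t \<and> slot_fun S w' (U \<omega>) \<le> t} =
    (\<Sum>s\<in>{0..<int S}. min (w s) (w' s)) * t / real S"
proof -
  define J where "J s = {\<omega> \<in> space M. U \<omega> \<in>
    {real_of_int s / real S <.. (real_of_int s + min (w s) (w' s) * t) / real S}}" for s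
  have J[measurable]: "J s \<in> events" for s unfolding J_def by measurable
  have min_bounds: "0 \<le> min (w s) (w' s) * t" "min (w s) (w' s) * t \<le> 1" for s
    using w w' assms by (auto intro: mult_le_one simp: min_le_iff_disj)
  have prob_J: "prob (J s) = min (w s) (w' s) * t / real S" if "s \<in> {0..<int S}" for s
  proof -
    let ?a = "real_of_int s / real S"
    let ?b = "(real_of_int s + min (w s) (w' s) * t) / real S"
    have "real_of_int s + 1 \<le> real S" using that by simp
    then have ab: "?a \<in> {0..1}" "?b \<in> {0..1}" "?a \<le> ?b"
      using min_bounds[of s] that \<open>S > 0\<close> by (auto simp: field_simps)
    have J_eq: "J s = {\<omega> \<in> space M. U \<omega> \<le> ?b} - {\<omega> \<in> space M. U \<omega> \<le> ?a}"
      by (auto simp: J_def)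
    have "{\<omega> \<in> space M. U \<omega> \<le> ?a} \<subseteq> {\<omega> \<in> space M. U \<omega> \<le> ?b}"
      using ab(3) by (blast intro: order_trans)
    then have "prob (J s) = prob {\<omega> \<in> space M. U \<omega> \<le> ?b} - prob {\<omega> \<in> space M. U \<omega> \<le> ?a}"
      unfolding J_eq by (intro finite_measure_Diff) measurable
    then have "prob (J s) = ?b - ?a" by (simp only: unif[OF ab(1)] unif[OF ab(2)])
    then show ?thesis by (simp add: add_divide_distrib)
  qed
  have "disjoint_family_on J {0..<int S}"
    unfolding disjoint_family_on_def
  proof (intro ballI impI)
    \<comment> \<open>The piece in slot \<open>s\<close> has length at most \<open>1 / S\<close>, so
      it does not leave the slot and the ceiling recovers \<open>s\<close>.\<close>
    have unique: "s = \<lceil>real S * U \<omega>\<rceil> - 1" if "\<omega> \<in> J s" for s \<omega>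
    proof -
      have "real_of_int s < real S * U \<omega>" "real S * U \<omega> \<le> real_of_int s + 1"
        using that min_bounds[of s] \<open>S > 0\<close> by (auto simp: J_def field_simps)
      then have "\<lceil>real S * U \<omega>\<rceil> = s + 1" by (intro ceiling_unique) auto
      then show ?thesis by simp
    qed
    fix s s' :: int assume "s \<noteq> s'"
    then show "J s \<inter> J s' = {}" using unique by blast
  qed
  then have "prob (\<Union>s\<in>{0..<int S}. J s) = (\<Sum>s\<in>{0..<int S}. prob (J s))"
    using J by (intro finite_measure_finite_Union) auto
  also have "\<dots> = (\<Sum>s\<in>{0..<int S}. min (w s) (w' s)) * t / real S"
    by (simp add: prob_J sum_distrib_right sum_divide_distrib)
  also have "(\<Union>s\<in>{0..<int S}. J s) =
      {\<omega> \<in> space M. U \<omega> \<in> {x. slot_fun S w x \<le> t \<and> slot_fun S w' x \<le> t}}"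
    using slot_fun_joint_le[of S t w w', OF assms(3-5) w] unfolding J_def by blast
  finally show ?thesis by simp
qed

section \<open>Sufficiency: realising sums of minima as tail dependence\<close>

text \<open>Weights with total 1 give every component the same distribution function
  \<open>t / S\<close> on the unit interval. Near 0 the tail event at level \<open>u\<close> is
  therefore \<open>X k \<omega> \<le> S * u\<close>, and the quotient in the coefficient is already
  constant there.\<close>

lemma (in prob_space) is_tail_dependence_matrix_sum_min:
  assumes "atomless M" and A: "A \<in> carrier_mat d d" and "S > 0"
    and w: "\<And>k s. 0 \<le> w k s" "\<And>k s. s \<notin> {0..<int S} \<Longrightarrow> w k s = 0"
    and sum: "\<And>k. k < d \<Longrightarrow> (\<Sum>s\<in>{0..<int S}. w k s) = 1"
    and entry: "\<And>k l. k < d \<Longrightarrow> l < d \<Longrightarrow> A $$ (k, l) = (\<Sum>s\<in>{0..<int S}. min (w k s) (w l s))"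
  shows "is_tail_dependence_matrix M A"
proof -
  obtain U :: "'a \<Rightarrow> real" where U[measurable]: "U \<in> borel_measurable M"
      and unif: "\<And>u. u \<in> {0..1} \<Longrightarrow> prob {\<omega> \<in> space M. U \<omega> \<le> u} = u"
      and null: "\<And>u. prob {\<omega> \<in> space M. U \<omega> = u} = 0"
    using atomless_imp_uniform[OF assms(1)] by blast
  define X where "X k \<omega> = slot_fun S (w k) (U \<omega>)" for k \<omega>
  have X[measurable]: "X k \<in> borel_measurable M" for k unfolding X_def by measurable
  have w_le: "w k s \<le> 1" if "k < d" for k s
  proof (cases "s \<in> {0..<int S}")
    case True
    then have "w k s \<le> (\<Sum>s\<in>{0..<int S}. w k s)" using w(1) by (intro member_le_sum) auto
    then show ?thesis using sum[OF that] by simp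
  qed (simp add: w(2))
  have cont: "continuous_on UNIV (distribution_function M (X k))" for k
  proof (subst continuous_distribution_function_iff[OF X], intro allI)
    fix t
    let ?L = "{x. slot_fun S (w k) x = t}"
    have "U -` {x} \<inter> space M \<in> null_sets M" for x
    proof -
      have "{\<omega> \<in> space M. U \<omega> = x} \<in> null_sets M"
        using null[of x] by (intro null_setsI) (auto simp: emeasure_eq_measure)
      then show ?thesis by (simp add: vimage_def Int_def conj_commute)
    qed
    then have "(\<Union>x\<in>?L. U -` {x} \<inter> space M) \<in> null_sets M"
      using slot_fun_level_countable[OF \<open>S > 0\<close>] by (intro null_sets_UN') auto
    moreover have "(\<Union>x\<in>?L. U -` {x} \<inter> space M) = {\<omega> \<in> space M. X k \<omega> = t}"
      by (auto simp: X_def)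
    ultimately show "prob {\<omega> \<in> space M. X k \<omega> = t} = 0"
      by (simp add: measure_def null_sets_def)
  qed
  have joint: "prob {\<omega> \<in> space M. X k \<omega> \<le> t \<and> X l \<omega> \<le> t} = A $$ (k, l) * t / real S"
    if "k < d" "l < d" "0 \<le> t" "t \<le> 1" for k l t
    unfolding X_def entry[OF that(1,2)]
    by (intro prob_slot_fun_joint U unif \<open>S > 0\<close> that w w_le)
  have df: "distribution_function M (X k) t = t / real S" if "k < d" "0 \<le> t" "t \<le> 1" for k t
    using joint[OF that(1,1) that(2,3)] entry[OF that(1,1)] sum[OF that(1)]
    by (simp add: distribution_function_eq[OF X])
  \<comment> \<open>Values above 1 are harmless: the distribution function is at least
    \<open>1 / S > u\<close> there, and \<open>S * u < 1\<close>, so both sides fail.\<close>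
  have tail: "distribution_function M (X k) (X k \<omega>) \<le> u \<longleftrightarrow> X k \<omega> \<le> real S * u"
    if "k < d" "0 < u" "u < 1 / real S" for k u \<omega>
  proof (cases "X k \<omega> \<le> 1")
    case True
    have "0 \<le> X k \<omega>" unfolding X_def using slot_fun_pos less_imp_le by blast
    then show ?thesis using df[of k "X k \<omega>"] that True \<open>S > 0\<close>
      by (simp add: pos_divide_le_eq mult.commute)
  next
    case False
    then have "distribution_function M (X k) 1 \<le> distribution_function M (X k) (X k \<omega>)"
      unfolding distribution_function_eq[OF X] by (intro finite_measure_mono) auto
    moreover have "distribution_function M (X k) 1 = 1 / real S" using df[of k 1] that by simp
    moreover have "real S * u < 1" using that \<open>S > 0\<close> by (simp add: field_simps)
    ultimately show ?thesis using False that by linarith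
  qed
  have "has_tail_dependence_coefficient M (X k) (X l) (A $$ (k, l))" if "k < d" "l < d" for k l
    unfolding has_tail_dependence_coefficient_def
  proof (rule tendsto_eventually)
    have "\<forall>\<^sub>F u in at_right 0. u < 1 / real S"
      using \<open>S > 0\<close> by (intro eventually_at_right_real[THEN eventually_mono]) auto
    then show "\<forall>\<^sub>F u in at_right 0. 1 / u * prob {\<omega> \<in> space M.
        distribution_function M (X k) (X k \<omega>) \<le> u \<and> distribution_function M (X l) (X l \<omega>) \<le> u}
        = A $$ (k, l)"
      using eventually_at_right_less[of 0]
    proof eventually_elim
      case (elim u)
      have "0 \<le> real S * u" "real S * u \<le> 1" using elim \<open>S > 0\<close> by (auto simp: field_simps)
      then show ?case
        using elim \<open>S > 0\<close> by (simp add: tail that joint)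
    qed
  qed
  then show ?thesis
    unfolding is_tail_dependence_matrix_def has_tail_dependence_matrix_def
    using A X cont by (intro exI[of _ X]) auto
qed

section \<open>The star matrix: both directions and explicit weights\<close>

theorem proposition4p7:
  fixes M :: "'a measure" and d :: nat and \<alpha> :: real
  assumes "prob_space M" and "atomless M"
    and "d \<ge> 2" and "\<alpha> \<in> {0..1}"
  shows "is_tail_dependence_matrix M (Gamma_mat d \<alpha>) \<longleftrightarrow> 0 \<le> \<alpha> \<and> \<alpha> \<le> 1 / (real d - 1)"
proof -
  interpret prob_space M by fact
  define n where "n = d - 1"
  have d: "d = Suc n" and "n > 0" using \<open>d \<ge> 2\<close> by (auto simp: n_def)
  have less_d: "i < d \<longleftrightarrow> i < Suc n" for i by (simp add: d)
  have \<alpha>: "0 \<le> \<alpha>" "\<alpha> \<le> 1" using assms(4) by auto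
  have G: "Gamma_mat d \<alpha> \<in> carrier_mat d d" by (simp add: Gamma_mat_def)
  have entry: "Gamma_mat d \<alpha> $$ (i, j) =
      (if i = j then 1 else if i = n \<or> j = n then \<alpha> else 0)" if "i < d" "j < d" for i j
    using that by (simp add: Gamma_mat_def n_def)
  have "real n * \<alpha> \<le> 1" if tdm: "is_tail_dependence_matrix M (Gamma_mat d \<alpha>)"
  proof -
    obtain X where "has_tail_dependence_matrix M (Suc n) X (Gamma_mat d \<alpha>)"
      using tdm G unfolding is_tail_dependence_matrix_def by (metis carrier_matD(1) d)
    then show ?thesis
      by (rule tail_dependence_star_bound) (auto simp: entry less_d)
  qed
  moreover have "is_tail_dependence_matrix M (Gamma_mat d \<alpha>)" if n\<alpha>: "real n * \<alpha> \<le> 1"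
  proof -
    \<comment> \<open>Slot \<open>s < n\<close> is shared by the components \<open>s\<close> and \<open>n\<close>, slot \<open>n + k\<close> is private to
      component \<open>k\<close>.\<close>
    define priv where "priv k = (if k = n then 1 - real n * \<alpha> else 1 - \<alpha>)" for k
    define w where "w k s = (if s \<in> {0..<int n} \<and> (s = int k \<or> k = n) then \<alpha>
      else if s = int (n + k) \<and> k < d then priv k else 0)" for k s
    \<comment> \<open>Private weights fill each component up to total 1: a component below
      \<open>n\<close> has spent \<alpha> on one shared slot, component \<open>n\<close> has spent
      it on all \<open>n\<close> of them. For the latter, nonnegativity is the hypothesis
      \<open>n\<alpha>\<close>.\<close>
    have priv: "0 \<le> priv k" for k using n\<alpha> \<alpha> by (simp add: priv_def)
    have split: "(\<Sum>s\<in>{0..<int (n + d)}. f s) =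
        (\<Sum>s\<in>{0..<int n}. f s) + (\<Sum>s\<in>{int n..<int (n + d)}. f s)" for f :: "int \<Rightarrow> real"
      by (subst sum.union_disjoint[symmetric]) (auto intro!: sum.cong)
    have sum_min: "(\<Sum>s\<in>{0..<int (n + d)}. min (w k s) (w l s)) = Gamma_mat d \<alpha> $$ (k, l)"
      if kl: "k < d" "l < d" for k l
    proof -
      have "(\<Sum>s\<in>{0..<int n}. min (w k s) (w l s)) =
          (if k = n \<and> l = n then real n * \<alpha> else if k = l \<or> k = n \<or> l = n then \<alpha> else 0)"
      proof (cases "k = n \<and> l = n")
        case True
        then show ?thesis by (simp add: w_def)
      next
        case False
        \<comment> \<open>Unless both indices are \<open>n\<close>, the only shared slot that can
          contribute is that of the smaller index; for distinct indices below \<open>n\<close> it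
          contributes 0.\<close>
        define m where "m = min k l"
        have "m < n" using False kl by (auto simp: m_def d)
        have "(\<Sum>s\<in>{0..<int n}. min (w k s) (w l s)) =
            (\<Sum>s\<in>{0..<int n}. if s = int m then if k = l \<or> k = n \<or> l = n then \<alpha> else 0 else 0)"
          using \<alpha> kl False by (intro sum.cong) (auto simp: w_def m_def d min_def)
        then show ?thesis using False \<open>m < n\<close> by auto
      qed
      \<comment> \<open>Among the private slots, slot \<open>n + k\<close> carries weight for
        component \<open>k\<close> alone, so distinct components do not overlap.\<close>
      moreover have "(\<Sum>s\<in>{int n..<int (n + d)}. min (w k s) (w l s)) =
          (\<Sum>s\<in>{int n..<int (n + d)}. if s = int (n + k) then if k = l then priv k else 0 else 0)"
        using kl priv[of k] priv[of l] by (intro sum.cong) (auto simp: w_def)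
      ultimately show ?thesis
        unfolding split using kl by (auto simp: entry priv_def)
    qed
    show ?thesis
    proof (rule is_tail_dependence_matrix_sum_min[OF \<open>atomless M\<close> G])
      show "n + d > 0" using \<open>n > 0\<close> by simp
      show "0 \<le> w k s" for k s using \<alpha> priv by (simp add: w_def)
      show "w k s = 0" if "s \<notin> {0..<int (n + d)}" for k s
        using that by (auto simp: w_def)
      \<comment> \<open>The minimum of a weight with itself is that weight, so the total weight is
        the diagonal entry.\<close>
      show "(\<Sum>s\<in>{0..<int (n + d)}. w k s) = 1" if "k < d" for k
        using sum_min[OF that that] entry[OF that that] by simp
    qed (use sum_min in simp)
  qed
  moreover have "\<alpha> \<le> 1 / (real d - 1) \<longleftrightarrow> real n * \<alpha> \<le> 1"
    using \<open>n > 0\<close> by (simp add: d field_simps)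
  ultimately show ?thesis using \<alpha> by blast
qed

end
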